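(* Let $n\ge1$, $k=6n$, let $M$ be an $n\times n$ Boolean matrix and $u,v\in\{0,1\}^n$. Let $G$ be the undirected graph constructed as follows. For each $1\le i,j\le n$ there is a bit graph $B_{i,j}$ on $k$ vertices, two of which are designated special vertex 1 and special vertex 2; if $M_{i,j}=1$, $B_{i,j}$ contains a path with $k-1$ edges through all its vertices from special vertex 1 to special vertex 2, and if $M_{i,j}=0$, $B_{i,j}$ has no internal edges. For each row $i$ there is a row graph $R_i$ on $3$ vertices, one of them special, and the special vertex of $R_i$ is joined to special vertex 1 of $B_{i,j}$ for every $1\le j\le n$; if $u_i=1$ then $R_i$ additionally contains all three edges among its vertices (a triangle), otherwise it has no internal edges. For each column $j$ there is a column graph $C_j$ on $3$ vertices, one of them special, whose special vertex is joined to special vertex 2 of $B_{i,j}$ for every $1\le i\le n$; if $v_j=1$ then $C_j$ is a triangle, otherwise it has no internal edges. Then there exists a nonempty subset $S$ of vertices of $G$ with density $\rho(S)\ge\frac{k+7}{k+6}$ if and only if $u^\top Mv=1$.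
   Context: For an undirected graph $G=(V,E)$ and nonempty $S\subseteq V$, $E(S)$ is the set of edges with both endpoints in $S$ and the density is $\rho(S)=|E(S)|/|S|$. $u^\top Mv$ is computed in Boolean arithmetic, i.e. it equals $1$ iff there exist $i,j$ with $u_i=M_{i,j}=v_j=1$. *)

theory Defs
  imports Complex_Main "Jordan_Normal_Form.Matrix"
begin

text \<open>
  Undirected graphs are pairs of a vertex set and a set of edges, an edge being the
  two-element set of its endpoints.
\<close>

type_synonym 'a ugraph = "'a set \<times> 'a set set"

definition verts :: "'a ugraph \<Rightarrow> 'a set" where
  "verts G = fst G"

definition edges :: "'a ugraph \<Rightarrow> 'a set set" where
  "edges G = snd G"

definition induced_edges :: "'a ugraph \<Rightarrow> 'a set \<Rightarrow> 'a set set" where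
  "induced_edges G S = {e \<in> edges G. e \<subseteq> S}"

definition density :: "'a ugraph \<Rightarrow> 'a set \<Rightarrow> real" where
  "density G S = real (card (induced_edges G S)) / real (card S)"

text \<open>The product of row vector, matrix and column vector over the Booleans (or of ands).\<close>

definition bool_vec_mat_vec :: "bool vec \<Rightarrow> bool mat \<Rightarrow> bool vec \<Rightarrow> bool" where
  "bool_vec_mat_vec u M v \<longleftrightarrow>
     (\<exists>i < dim_row M. \<exists>j < dim_col M. u $ i \<and> M $$ (i, j) \<and> v $ j)"

text \<open>
  All indices start at \<open>0\<close>. The vertices \<open>Bit i j 0, \<dots>, Bit i j (k - 1)\<close> of a bit graph
  are numbered in the order of its path, so \<open>Bit i j 0\<close> is special vertex 1 and
  \<open>Bit i j (k - 1)\<close> is special vertex 2. The special vertices of the row graph \<open>i\<close> and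
  the column graph \<open>j\<close> are \<open>Row i 0\<close> and \<open>Col j 0\<close>.
\<close>

datatype vertex = Bit nat nat nat | Row nat nat | Col nat nat

definition bit_graph :: "nat \<Rightarrow> bool mat \<Rightarrow> nat \<Rightarrow> nat \<Rightarrow> vertex ugraph" where
  "bit_graph k M i j =
     (Bit i j ` {..<k},
      if M $$ (i, j) then {{Bit i j l, Bit i j (Suc l)} | l. Suc l < k} else {})"

definition row_graph :: "bool vec \<Rightarrow> nat \<Rightarrow> vertex ugraph" where
  "row_graph u i =
     (Row i ` {..<3},
      if u $ i then {{Row i a, Row i b} | a b. a < 3 \<and> b < 3 \<and> a \<noteq> b} else {})"

definition col_graph :: "bool vec \<Rightarrow> nat \<Rightarrow> vertex ugraph" where
  "col_graph v j =
     (Col j ` {..<3},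
      if v $ j then {{Col j a, Col j b} | a b. a < 3 \<and> b < 3 \<and> a \<noteq> b} else {})"

definition reduction_graph ::
  "nat \<Rightarrow> nat \<Rightarrow> bool mat \<Rightarrow> bool vec \<Rightarrow> bool vec \<Rightarrow> vertex ugraph" where
  "reduction_graph n k M u v =
     ((\<Union>i<n. \<Union>j<n. verts (bit_graph k M i j))
        \<union> (\<Union>i<n. verts (row_graph u i))
        \<union> (\<Union>j<n. verts (col_graph v j)),
      (\<Union>i<n. \<Union>j<n. edges (bit_graph k M i j))
        \<union> (\<Union>i<n. edges (row_graph u i))
        \<union> (\<Union>j<n. edges (col_graph v j))
        \<union> {{Row i 0, Bit i j 0} | i j. i < n \<and> j < n}
        \<union> {{Col j 0, Bit i j (k - 1)} | i j. i < n \<and> j < n})"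

lemma reduction_graph_simple:
  assumes "k \<ge> 1" and "e \<in> edges (reduction_graph n k M u v)"
  shows "e \<subseteq> verts (reduction_graph n k M u v) \<and> card e = 2"
  using assms
  by (fastforce simp: reduction_graph_def bit_graph_def row_graph_def col_graph_def
      verts_def edges_def card_insert_if split: if_splits)

end

theory Submission
  imports Defs
begin

text \<open>
  Charge every link edge to the bit graph it enters. A bit graph then has at most as many
  edges in \<open>S\<close> as vertices, and exceeds this by one only if its whole path and both
  adjacent special vertices lie in \<open>S\<close>; let \<open>p\<close> count these pairs \<open>(i, j)\<close>. A row or column
  graph never has more edges than vertices in \<open>S\<close>, and has fewer if its special vertex lies
  in \<open>S\<close> but it is not a triangle inside \<open>S\<close>; let \<open>d\<close> count these deficient ones. Then
  \<open>|E(S)| + d \<le> |S| + p\<close> and \<open>k p \<le> |S|\<close>. If the product is \<open>0\<close>, every pair counted by \<open>p\<close>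
  involves a deficient row or column, so \<open>p \<le> n d\<close>. For \<open>k = 6 n\<close> these inequalities exclude
  density \<open>(k + 7) / (k + 6)\<close>. Conversely a witness \<open>i, j\<close> of product \<open>1\<close> yields the set of
  all vertices of bit graph \<open>(i, j)\<close>, row graph \<open>i\<close> and column graph \<open>j\<close>.
\<close>

section \<open>Edge excess of a bit graph\<close>

text \<open>Each maximal run of consecutive elements of \<open>L\<close> has one path edge fewer
  than elements, so the edges inside \<open>L\<close> number \<open>card L\<close> minus the number
  of runs. A nonempty \<open>L\<close> has at least one run, and at least two if it contains both
  ends of the path without being the whole path.\<close>

lemma path_edges_le:
  fixes k :: nat
  assumes "L \<subseteq> {..<k}"
  shows "card {l \<in> L. Suc l \<in> L} + of_bool (0 \<in> L) + of_bool (k - 1 \<in> L)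
    \<le> card L + of_bool (L = {..<k})"
    and "card {l \<in> L. Suc l \<in> L} + of_bool (L \<noteq> {}) \<le> card L"
proof -
  have fin: "finite L" using assms finite_subset by blast
  \<comment> \<open>\<open>D\<close> holds the last element of every run, so \<open>card D\<close>
    is the number of runs.\<close>
  define D where "D = {l \<in> L. Suc l \<notin> L}"
  have fD: "finite D" using fin by (simp add: D_def)
  have "L = {l \<in> L. Suc l \<in> L} \<union> D" by (auto simp: D_def)
  moreover have "card ({l \<in> L. Suc l \<in> L} \<union> D) = card {l \<in> L. Suc l \<in> L} + card D"
    by (rule card_Un_disjoint) (use fin in \<open>auto simp: D_def\<close>)
  ultimately have split: "card L = card {l \<in> L. Suc l \<in> L} + card D" by simp
  have D0: "card D > 0" if "L \<noteq> {}"
  proof -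
    have "Max L \<in> L" using fin that by simp
    moreover have "Suc (Max L) \<notin> L" using fin Max_ge not_less_eq_eq by blast
    ultimately have "Max L \<in> D" by (simp add: D_def)
    then show ?thesis using fD card_gt_0_iff by blast
  qed
  show "card {l \<in> L. Suc l \<in> L} + of_bool (L \<noteq> {}) \<le> card L"
    using D0 split by (cases "L = {}") simp_all
  have D2: "card D \<ge> 2" if z: "0 \<in> L" and e: "k - 1 \<in> L" and nf: "L \<noteq> {..<k}"
  proof -
    \<comment> \<open>Some run ends before \<open>k - 1\<close>: otherwise membership in
      \<open>L\<close> propagates from \<open>0\<close> along the entire path, which contradicts
      \<open>nf\<close>.\<close>
    have "\<exists>l \<in> D. l < k - 1"
    proof (rule ccontr)
      assume *: "\<not> ?thesis"
      have "l < k \<longrightarrow> l \<in> L" for l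
        by (induction l) (use * z in \<open>auto simp: D_def\<close>)
      then show False using assms nf by auto
    qed
    then obtain l where l: "l \<in> D" "l < k - 1" by blast
    have "k - 1 \<in> D" using e assms by (auto simp: D_def)
    then have "{l, k - 1} \<subseteq> D" using l by simp
    then have "card {l, k - 1} \<le> card D" using fD card_mono by blast
    then show ?thesis using l by simp
  qed
  show "card {l \<in> L. Suc l \<in> L} + of_bool (0 \<in> L) + of_bool (k - 1 \<in> L)
    \<le> card L + of_bool (L = {..<k})"
    using D0 D2 split
    by (cases "L = {}"; cases "L = {..<k}"; cases "0 \<in> L"; cases "k - 1 \<in> L") simp_all
qed

text \<open>If both adjacent special vertices lie in \<open>S\<close>, the two link edges are paid
  for by the end terms of the first bound in \<open>path_edges_le\<close>. Otherwise at most one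
  link edge lies in \<open>S\<close>, and the second bound leaves room for it.\<close>

lemma bit_graph_excess:
  fixes S :: "vertex set"
  assumes "k \<ge> 2"
  shows "card (induced_edges (bit_graph k M i j) S
        \<union> {e \<in> {{Row i 0, Bit i j 0}, {Col j 0, Bit i j (k - 1)}}. e \<subseteq> S})
    \<le> card (S \<inter> Bit i j ` {..<k})
      + of_bool (M $$ (i, j) \<and> Row i 0 \<in> S \<and> Col j 0 \<in> S \<and> Bit i j ` {..<k} \<subseteq> S)"
    (is "card (?P \<union> ?Q) \<le> card ?B + of_bool ?full")
proof -
  define L where "L = {l \<in> {..<k}. Bit i j l \<in> S}"
  have Lk: "L \<subseteq> {..<k}" by (auto simp: L_def)
  have fL: "finite L" by (simp add: L_def)
  have "?B = Bit i j ` L" by (auto simp: L_def)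
  then have cB: "card ?B = card L" by (simp add: card_image inj_on_def)
  let ?r = "Row i 0 \<in> S" and ?c = "Col j 0 \<in> S"
  have cQ: "card ?Q \<le> of_bool (?r \<and> 0 \<in> L) + of_bool (?c \<and> k - 1 \<in> L)"
  proof -
    have "?Q = (if ?r \<and> 0 \<in> L then {{Row i 0, Bit i j 0}} else {})
        \<union> (if ?c \<and> k - 1 \<in> L then {{Col j 0, Bit i j (k - 1)}} else {})"
      using assms by (auto simp: L_def)
    also have "card \<dots> \<le> of_bool (?r \<and> 0 \<in> L) + of_bool (?c \<and> k - 1 \<in> L)"
      by (rule order_trans[OF card_Un_le]) auto
    finally show ?thesis .
  qed
  have PQ: "card (?P \<union> ?Q) \<le> card ?P + card ?Q" by (rule card_Un_le)
  show ?thesis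
  proof (cases "M $$ (i, j)")
    case False
    then have P: "?P = {}" by (simp add: induced_edges_def bit_graph_def edges_def)
    \<comment> \<open>Without path edges, each link edge is charged to its own endpoint in the bit
      graph; these endpoints are distinct since \<open>k \<ge> 2\<close>.\<close>
    have "card ({0, k - 1} \<inter> L) \<le> card L" using fL by (simp add: card_mono)
    moreover have "of_bool (?r \<and> 0 \<in> L) + of_bool (?c \<and> k - 1 \<in> L) \<le> card ({0, k - 1} \<inter> L)"
      using assms by (auto simp: of_bool_def Int_insert_left)
    ultimately show ?thesis using cQ cB P by simp
  next
    case True
    have "?P = (\<lambda>l. {Bit i j l, Bit i j (Suc l)}) ` {l \<in> L. Suc l \<in> L}"
      using True by (auto simp: induced_edges_def bit_graph_def edges_def L_def)
    then have cP: "card ?P \<le> card {l \<in> L. Suc l \<in> L}"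
      using fL by (simp add: card_image_le)
    have full: "L = {..<k} \<longleftrightarrow> Bit i j ` {..<k} \<subseteq> S" by (auto simp: L_def)
    show ?thesis
    proof (cases "?r \<and> ?c")
      case True
      then have "card ?Q \<le> of_bool (0 \<in> L) + of_bool (k - 1 \<in> L)" using cQ by simp
      then have "card (?P \<union> ?Q) \<le> card ?B + of_bool (L = {..<k})"
        using PQ cP cB path_edges_le(1)[OF Lk] by linarith
      moreover have "L = {..<k} \<longleftrightarrow> ?full" using True \<open>M $$ (i, j)\<close> full by blast
      ultimately show ?thesis by simp
    next
      case False
      then have "of_bool (?r \<and> 0 \<in> L) + of_bool (?c \<and> k - 1 \<in> L) \<le> (of_bool (L \<noteq> {}) :: nat)"
        by auto
      then have "card ?Q \<le> of_bool (L \<noteq> {})" using cQ by linarith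
      then have "card (?P \<union> ?Q) \<le> card ?B"
        using PQ cP cB path_edges_le(2)[OF Lk] by linarith
      then show ?thesis by linarith
    qed
  qed
qed

section \<open>Edge deficit of row and column graphs\<close>

lemma triangle_edges:
  fixes f :: "nat \<Rightarrow> 'a"
  shows "{{f a, f b} | a b. a < 3 \<and> b < 3 \<and> a \<noteq> b} = {{f 0, f 1}, {f 0, f 2}, {f 1, f 2}}"
    (is "?T = ?E")
proof
  have less3: "a = 0 \<or> a = 1 \<or> a = 2" if "a < 3" for a :: nat using that by auto
  show "?T \<subseteq> ?E" by (auto dest!: less3)
  have "{f a, f b} \<in> ?T" if "a < 3" "b < 3" "a \<noteq> b" for a b using that by blast
  from this[of 0 1] this[of 0 2] this[of 1 2] show "?E \<subseteq> ?T" by simp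
qed

text \<open>Among subsets of a triangle, those with 0, 1, 2, 3 vertices span 0, 0, 1, 3 edges, so
  only the empty and the full subset have no deficit. The proof checks all eight subsets.\<close>

lemma triangle_deficit:
  fixes f :: "nat \<Rightarrow> 'a"
  assumes "inj f"
  shows "card {e \<in> {{f a, f b} | a b. a < 3 \<and> b < 3 \<and> a \<noteq> b}. e \<subseteq> S}
      + of_bool (f 0 \<in> S \<and> \<not> f ` {..<3} \<subseteq> S)
    \<le> card (S \<inter> f ` {..<3})"
proof -
  have three: "{..<3} = {0, 1, 2 :: nat}" by auto
  have "f 0 \<noteq> f 1" "f 0 \<noteq> f 2" "f 1 \<noteq> f 2"
    using assms by (auto dest: injD)
  moreover have filter_insert: "{e \<in> insert x A. e \<subseteq> S}
      = (if x \<subseteq> S then insert x {e \<in> A. e \<subseteq> S} else {e \<in> A. e \<subseteq> S})"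
    for x :: "'a set" and A by auto
  ultimately show ?thesis
    unfolding three triangle_edges filter_insert
    by (cases "f 0 \<in> S"; cases "f 1 \<in> S"; cases "f 2 \<in> S")
      (simp_all add: Int_insert_right card_insert_if doubleton_eq_iff)
qed

lemma row_graph_deficit:
  "card (induced_edges (row_graph u i) S)
      + of_bool (Row i 0 \<in> S \<and> \<not> (u $ i \<and> Row i ` {..<3} \<subseteq> S))
    \<le> card (S \<inter> Row i ` {..<3})"
proof (cases "u $ i")
  case True
  then show ?thesis
    using triangle_deficit[of "Row i" S]
    by (simp add: induced_edges_def row_graph_def edges_def inj_def)
next
  case False
  \<comment> \<open>With no edges at all, the special vertex by itself supplies the missing
    unit.\<close>
  have "Row i 0 \<in> S \<Longrightarrow> card (S \<inter> Row i ` {..<3}) > 0"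
    by (subst card_gt_0_iff) auto
  with False show ?thesis
    by (auto simp: induced_edges_def row_graph_def edges_def Suc_le_eq)
qed

lemma col_graph_deficit:
  "card (induced_edges (col_graph v j) S)
      + of_bool (Col j 0 \<in> S \<and> \<not> (v $ j \<and> Col j ` {..<3} \<subseteq> S))
    \<le> card (S \<inter> Col j ` {..<3})"
proof (cases "v $ j")
  case True
  then show ?thesis
    using triangle_deficit[of "Col j" S]
    by (simp add: induced_edges_def col_graph_def edges_def inj_def)
next
  case False
  have "Col j 0 \<in> S \<Longrightarrow> card (S \<inter> Col j ` {..<3}) > 0"
    by (subst card_gt_0_iff) auto
  with False show ?thesis
    by (auto simp: induced_edges_def col_graph_def edges_def Suc_le_eq)
qed

section \<open>Decomposition of the reduction graph\<close>

lemma card_reduction_subset: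
  assumes "S \<subseteq> verts (reduction_graph n k M u v)"
  shows "card S = (\<Sum>(i, j)\<in>{..<n} \<times> {..<n}. card (S \<inter> Bit i j ` {..<k}))
    + (\<Sum>i<n. card (S \<inter> Row i ` {..<3})) + (\<Sum>j<n. card (S \<inter> Col j ` {..<3}))"
proof -
  let ?B = "\<Union>p\<in>{..<n} \<times> {..<n}. S \<inter> Bit (fst p) (snd p) ` {..<k}"
  let ?R = "\<Union>i<n. S \<inter> Row i ` {..<3}"
  let ?C = "\<Union>j<n. S \<inter> Col j ` {..<3}"
  have "S = (?B \<union> ?R) \<union> ?C"
    using assms
    by (fastforce simp: reduction_graph_def bit_graph_def row_graph_def col_graph_def verts_def)
  moreover have "card ((?B \<union> ?R) \<union> ?C) = card (?B \<union> ?R) + card ?C"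
    by (rule card_Un_disjoint) auto
  moreover have "card (?B \<union> ?R) = card ?B + card ?R"
    by (rule card_Un_disjoint) auto
  moreover have "card ?B = (\<Sum>p\<in>{..<n} \<times> {..<n}. card (S \<inter> Bit (fst p) (snd p) ` {..<k}))"
    by (rule card_UN_disjoint) auto
  moreover have "card ?R = (\<Sum>i<n. card (S \<inter> Row i ` {..<3}))"
    by (rule card_UN_disjoint) auto
  moreover have "card ?C = (\<Sum>j<n. card (S \<inter> Col j ` {..<3}))"
    by (rule card_UN_disjoint) auto
  ultimately show ?thesis by (simp add: case_prod_unfold)
qed

text \<open>Once every link edge is grouped with the bit graph it enters, the three families cover
  all induced edges, and subadditivity of cardinality gives the bound.\<close>

lemma card_induced_reduction_le:
  "card (induced_edges (reduction_graph n k M u v) S)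
    \<le> (\<Sum>(i, j)\<in>{..<n} \<times> {..<n}. card (induced_edges (bit_graph k M i j) S
        \<union> {e \<in> {{Row i 0, Bit i j 0}, {Col j 0, Bit i j (k - 1)}}. e \<subseteq> S}))
    + (\<Sum>i<n. card (induced_edges (row_graph u i) S))
    + (\<Sum>j<n. card (induced_edges (col_graph v j) S))"
proof -
  let ?E = "\<lambda>i j. induced_edges (bit_graph k M i j) S
        \<union> {e \<in> {{Row i 0, Bit i j 0}, {Col j 0, Bit i j (k - 1)}}. e \<subseteq> S}"
  let ?B = "\<Union>p\<in>{..<n} \<times> {..<n}. ?E (fst p) (snd p)"
  let ?R = "\<Union>i<n. induced_edges (row_graph u i) S"
  let ?C = "\<Union>j<n. induced_edges (col_graph v j) S"
  have "induced_edges (reduction_graph n k M u v) S = (?B \<union> ?R) \<union> ?C"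
    unfolding reduction_graph_def induced_edges_def edges_def by fastforce
  moreover have "card ((?B \<union> ?R) \<union> ?C) \<le> card (?B \<union> ?R) + card ?C"
    by (rule card_Un_le)
  moreover have "card (?B \<union> ?R) \<le> card ?B + card ?R"
    by (rule card_Un_le)
  moreover have "card ?B \<le> (\<Sum>p\<in>{..<n} \<times> {..<n}. card (?E (fst p) (snd p)))"
    by (rule card_UN_le) simp
  moreover have "card ?R \<le> (\<Sum>i<n. card (induced_edges (row_graph u i) S))"
    by (rule card_UN_le) simp
  moreover have "card ?C \<le> (\<Sum>j<n. card (induced_edges (col_graph v j) S))"
    by (rule card_UN_le) simp
  ultimately show ?thesis by (simp add: case_prod_unfold)
qed

section \<open>Sparse and dense vertex sets\<close>

text \<open>Clearing the positive denominators lets both directions of the theorem be argued in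
  natural numbers.\<close>

lemma density_ge_iff:
  assumes "finite S" "S \<noteq> {}"
  shows "(real k + 7) / (real k + 6) \<le> density G S
    \<longleftrightarrow> (k + 7) * card S \<le> (k + 6) * card (induced_edges G S)"
proof -
  have "card S > 0" using assms by (simp add: card_gt_0_iff)
  then have "(real k + 7) / (real k + 6) \<le> density G S
    \<longleftrightarrow> (real k + 7) * real (card S) \<le> (real k + 6) * real (card (induced_edges G S))"
    by (simp add: density_def field_simps)
  also have "\<dots> \<longleftrightarrow> real ((k + 7) * card S) \<le> real ((k + 6) * card (induced_edges G S))"
    by simp
  finally show ?thesis by (simp only: of_nat_le_iff)
qed

lemma sparse_if_product_zero:
  assumes "n \<ge> 1" and k: "k = 6 * n" and M: "M \<in> carrier_mat n n"
    and zero: "\<not> bool_vec_mat_vec u M v"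
    and S: "S \<subseteq> verts (reduction_graph n k M u v)" "finite S" "S \<noteq> {}"
  shows "(k + 6) * card (induced_edges (reduction_graph n k M u v) S) < (k + 7) * card S"
proof -
  let ?I = "{..<n} \<times> {..<n}"
  define full where "full = (\<lambda>(i, j). M $$ (i, j) \<and> Row i 0 \<in> S \<and> Col j 0 \<in> S
    \<and> Bit i j ` {..<k} \<subseteq> S)"
  define dr where "dr i \<longleftrightarrow> Row i 0 \<in> S \<and> \<not> (u $ i \<and> Row i ` {..<3} \<subseteq> S)" for i
  define dc where "dc j \<longleftrightarrow> Col j 0 \<in> S \<and> \<not> (v $ j \<and> Col j ` {..<3} \<subseteq> S)" for j
  define p where "p = card {x \<in> ?I. full x}"
  define d where "d = card {i \<in> {..<n}. dr i} + card {j \<in> {..<n}. dc j}"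
  define s where "s = card S"
  define e where "e = card (induced_edges (reduction_graph n k M u v) S)"
  let ?B = "\<lambda>x. case x of (i, j) \<Rightarrow> card (S \<inter> Bit i j ` {..<k})"
  have "s = sum ?B ?I
      + (\<Sum>i<n. card (S \<inter> Row i ` {..<3})) + (\<Sum>j<n. card (S \<inter> Col j ` {..<3}))"
    unfolding s_def by (rule card_reduction_subset[OF S(1)])
  moreover have psum: "p = (\<Sum>x\<in>?I. of_bool (full x))"
    by (simp add: p_def Int_def)
  moreover have "d = (\<Sum>i<n. of_bool (dr i)) + (\<Sum>j<n. of_bool (dc j))"
    by (simp add: d_def Int_def)
  moreover note card_induced_reduction_le[of n k M u v S, folded e_def]
  moreover have "(\<Sum>(i, j)\<in>?I. card (induced_edges (bit_graph k M i j) S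
        \<union> {e \<in> {{Row i 0, Bit i j 0}, {Col j 0, Bit i j (k - 1)}}. e \<subseteq> S}))
      \<le> sum ?B ?I + (\<Sum>x\<in>?I. of_bool (full x))"
    unfolding sum.distrib[symmetric]
  proof (rule sum_mono)
    fix x
    have "k \<ge> 2" using assms(1) k by simp
    from bit_graph_excess[OF this, of M "fst x" "snd x" S]
    show "(case x of (i, j) \<Rightarrow> card (induced_edges (bit_graph k M i j) S
        \<union> {e \<in> {{Row i 0, Bit i j 0}, {Col j 0, Bit i j (k - 1)}}. e \<subseteq> S}))
      \<le> ?B x + of_bool (full x)"
      by (simp only: full_def case_prod_unfold)
  qed
  moreover have "(\<Sum>i<n. card (induced_edges (row_graph u i) S)) + (\<Sum>i<n. of_bool (dr i))
      \<le> (\<Sum>i<n. card (S \<inter> Row i ` {..<3}))"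
    unfolding sum.distrib[symmetric] dr_def by (intro sum_mono row_graph_deficit)
  moreover have "(\<Sum>j<n. card (induced_edges (col_graph v j) S)) + (\<Sum>j<n. of_bool (dc j))
      \<le> (\<Sum>j<n. card (S \<inter> Col j ` {..<3}))"
    unfolding sum.distrib[symmetric] dc_def by (intro sum_mono col_graph_deficit)
  ultimately have balance: "e + d \<le> s + p" and B: "sum ?B ?I \<le> s" by linarith+
  \<comment> \<open>Each full pair contributes all \<open>k\<close> vertices of its bit graph to the
    vertex sum.\<close>
  have "k * p = (\<Sum>x\<in>?I. k * of_bool (full x))"
    by (simp only: psum sum_distrib_left)
  also have "\<dots> \<le> sum ?B ?I"
  proof (rule sum_mono, clarify)
    fix i j
    have "card (S \<inter> Bit i j ` {..<k}) = k" if "full (i, j)"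
      using that by (simp add: full_def Int_absorb1 card_image inj_on_def)
    then show "k * of_bool (full (i, j)) \<le> card (S \<inter> Bit i j ` {..<k})" by auto
  qed
  also note B
  finally have kp: "k * p \<le> s" .
  \<comment> \<open>For a full pair with neither \<open>dr i\<close> nor \<open>dc j\<close>, both
    \<open>u $ i\<close> and \<open>v $ j\<close> would hold, making the product 1.\<close>
  have "{x \<in> ?I. full x} \<subseteq> {i \<in> {..<n}. dr i} \<times> {..<n} \<union> {..<n} \<times> {j \<in> {..<n}. dc j}"
    using zero M by (auto simp: full_def dr_def dc_def bool_vec_mat_vec_def)
  then have "p \<le> card ({i \<in> {..<n}. dr i} \<times> {..<n} \<union> {..<n} \<times> {j \<in> {..<n}. dc j})"
    unfolding p_def by (intro card_mono) auto
  \<comment> \<open>A deficient row or column occurs in only \<open>n\<close> index pairs.\<close>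
  also have "\<dots> \<le> n * d"
    by (rule order_trans[OF card_Un_le]) (simp add: d_def algebra_simps)
  finally have pd: "p \<le> n * d" .
  have "s > 0" using S by (simp add: s_def card_gt_0_iff)
  have "(k + 6) * (e + d) \<le> (k + 6) * (s + p)"
    using balance by (rule mult_le_mono2)
  then have "(k + 6) * e + k * d + 6 * d \<le> (k + 6) * s + k * p + 6 * p"
    by (simp add: algebra_simps)
  \<comment> \<open>The choice \<open>k = 6 * n\<close> is made for this:
    \<open>6 * p \<le> 6 * n * d = k * d\<close>, so these two terms cancel from the
    balance.\<close>
  moreover have "6 * p \<le> k * d" using pd k by simp
  ultimately have main: "(k + 6) * e + 6 * d \<le> (k + 6) * s + k * p" by linarith
  show ?thesis
  proof (cases "d = 0")
    case True
    then have "(k + 6) * e \<le> (k + 6) * s" using main pd by simp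
    also have "\<dots> < (k + 7) * s" using \<open>s > 0\<close> by simp
    finally show ?thesis unfolding e_def s_def .
  next
    case False
    then have "(k + 6) * e < (k + 6) * s + s" using main kp by linarith
    then show ?thesis unfolding e_def s_def by (simp add: algebra_simps)
  qed
qed

text \<open>The edges are the \<open>k - 1\<close> path edges, three in each of the two triangles,
  and two links: \<open>(k - 1) + 3 + 3 + 2 = k + 7\<close>.\<close>

lemma dense_if_product_one:
  assumes "k \<ge> 2" and ij: "i < n" "j < n" and one: "u $ i" "M $$ (i, j)" "v $ j"
  defines "S \<equiv> Bit i j ` {..<k} \<union> Row i ` {..<3} \<union> Col j ` {..<3}"
  shows "S \<subseteq> verts (reduction_graph n k M u v)" and "card S = k + 6"
    and "card (induced_edges (reduction_graph n k M u v) S) \<ge> k + 7"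
proof -
  show "S \<subseteq> verts (reduction_graph n k M u v)"
    using ij by (auto simp: S_def reduction_graph_def bit_graph_def row_graph_def
        col_graph_def verts_def)
  have "card S = card (Bit i j ` {..<k} \<union> Row i ` {..<3}) + card (Col j ` {..<3::nat})"
    unfolding S_def by (rule card_Un_disjoint) auto
  also have "card (Bit i j ` {..<k} \<union> Row i ` {..<3})
      = card (Bit i j ` {..<k}) + card (Row i ` {..<3::nat})"
    by (rule card_Un_disjoint) auto
  finally show "card S = k + 6" by (simp add: card_image inj_on_def)
  let ?P = "(\<lambda>l. {Bit i j l, Bit i j (Suc l)}) ` {..<k - 1}"
  let ?R = "{{Row i 0, Row i 1}, {Row i 0, Row i 2}, {Row i 1, Row i 2}}"
  let ?C = "{{Col j 0, Col j 1}, {Col j 0, Col j 2}, {Col j 1, Col j 2}}"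
  let ?L = "{{Row i 0, Bit i j 0}, {Col j 0, Bit i j (k - 1)}}"
  let ?G = "reduction_graph n k M u v"
  have G: "edges (bit_graph k M i j) \<subseteq> edges ?G" "edges (row_graph u i) \<subseteq> edges ?G"
      "edges (col_graph v j) \<subseteq> edges ?G"
    using ij by (auto simp: reduction_graph_def edges_def)
  have "?P \<subseteq> edges (bit_graph k M i j)"
    using one by (auto simp: bit_graph_def edges_def)
  then have P: "?P \<subseteq> edges ?G" using G(1) by (rule subset_trans)
  have "?R \<subseteq> edges (row_graph u i)"
    using one unfolding row_graph_def edges_def triangle_edges by simp
  then have R: "?R \<subseteq> edges ?G" using G(2) by (rule subset_trans)
  have "?C \<subseteq> edges (col_graph v j)"
    using one unfolding col_graph_def edges_def triangle_edges by simp
  then have C: "?C \<subseteq> edges ?G" using G(3) by (rule subset_trans)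
  have L: "?L \<subseteq> edges ?G" using ij by (auto simp: reduction_graph_def edges_def)
  have induced: "A \<subseteq> induced_edges ?G S" if "A \<subseteq> edges ?G" "\<Union>A \<subseteq> S" for A
    using that by (auto simp: induced_edges_def)
  have sub: "?P \<union> (?R \<union> ?C \<union> ?L) \<subseteq> induced_edges ?G S"
    using assms(1) by (intro induced Un_least P R C L) (auto simp: S_def)
  \<comment> \<open>Path edges have only \<open>Bit\<close> vertices, while every other listed edge
    contains a \<open>Row\<close> or \<open>Col\<close> vertex.\<close>
  have "card (?P \<union> (?R \<union> ?C \<union> ?L)) = card ?P + card (?R \<union> ?C \<union> ?L)"
    by (rule card_Un_disjoint) (auto simp: doubleton_eq_iff)
  moreover have "card ?P = k - 1"
    by (simp add: card_image inj_on_def doubleton_eq_iff)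
  moreover have "card (?R \<union> ?C \<union> ?L) = 8"
    by (simp add: card_insert_if doubleton_eq_iff)
  moreover have "finite (induced_edges ?G S)"
    by (rule finite_subset[of _ "Pow S"]) (auto simp: induced_edges_def S_def)
  ultimately show "card (induced_edges ?G S) \<ge> k + 7"
    using card_mono[OF _ sub] assms(1) by simp
qed

section \<open>Equivalence of the density threshold and the Boolean product\<close>

theorem theorem3p24:
  fixes n k :: nat and M :: "bool mat" and u v :: "bool vec"
  assumes "n \<ge> 1"
    and "k = 6 * n"
    and "M \<in> carrier_mat n n"
    and "u \<in> carrier_vec n"
    and "v \<in> carrier_vec n"
  shows "(\<exists>S. S \<noteq> {} \<and> S \<subseteq> verts (reduction_graph n k M u v) \<and>
            density (reduction_graph n k M u v) S \<ge> (real k + 7) / (real k + 6))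
         \<longleftrightarrow> bool_vec_mat_vec u M v"
proof
  let ?G = "reduction_graph n k M u v"
  assume "\<exists>S. S \<noteq> {} \<and> S \<subseteq> verts ?G \<and> density ?G S \<ge> (real k + 7) / (real k + 6)"
  then obtain S where S: "S \<noteq> {}" "S \<subseteq> verts ?G"
    and dense: "density ?G S \<ge> (real k + 7) / (real k + 6)" by blast
  have "finite (verts ?G)"
    by (simp add: reduction_graph_def bit_graph_def row_graph_def col_graph_def verts_def)
  then have "finite S" using S finite_subset by blast
  then show "bool_vec_mat_vec u M v"
    using sparse_if_product_zero[OF assms(1-3) _ S(2)] S(1) dense density_ge_iff
    by (metis not_le)
next
  let ?G = "reduction_graph n k M u v"
  assume "bool_vec_mat_vec u M v"
  then obtain i j where "i < n" "j < n" "u $ i" "M $$ (i, j)" "v $ j"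
    using assms(3) by (auto simp: bool_vec_mat_vec_def)
  moreover have "k \<ge> 2" using assms(1,2) by simp
  moreover define S where "S = Bit i j ` {..<k} \<union> Row i ` {..<3} \<union> Col j ` {..<3}"
  ultimately have S: "S \<subseteq> verts ?G" "card S = k + 6" "card (induced_edges ?G S) \<ge> k + 7"
    using dense_if_product_one[of k i n j u M v] by simp_all
  then have "finite S" "S \<noteq> {}" by (auto simp: S_def)
  moreover have "(k + 7) * card S \<le> (k + 6) * card (induced_edges ?G S)"
    using mult_le_mono2[OF S(3), of "k + 6"] S(2) by (simp only: mult.commute)
  ultimately show "\<exists>S. S \<noteq> {} \<and> S \<subseteq> verts ?G \<and> density ?G S \<ge> (real k + 7) / (real k + 6)"
    using S(1) density_ge_iff by metis
qed

end
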